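(* Let $S$ be a homogeneous and finitely presented monoid (possibly with zero). Then the following conditions are equivalent: (i) $S$ has at most linear growth; (ii) $S$ is a finite union of sandwiches; (iii) $S$ is a union of a finite subset and a finite disjoint union of free sandwiches (that is, $S = F \cup \bigcup_{i=1}^{k} U_i$ where $F$ is a finite subset of $S$, $k \ge 0$, and $U_1,\dots,U_k$ are pairwise disjoint free sandwiches in $S$).
   Context: Homogeneous monoid: a monoid $S$ is homogeneous if its relations are degree-preserving with respect to some weight function. That is, for some set of generators $X$ of $S$ there is a function $d : X \to \mathbb{Z}_{>0}$ such that all (defining) relations of $S$ on $X$ have either the form $w = 0$ (allowed if $S$ contains a zero, in which case $S$ is presented as a monoid with zero) or the form $w = u$ with $d(w) = d(u)$, where for a word $w = x_1 \cdots x_k$ on the generators $d(w) := d(x_1) + \dots + d(x_k)$. Finitely presented means having a presentation with finitely many generators and finitely many relations (as a monoid, or as a monoid with zero if $S$ contains zero). Sandwich: for elements $a, b, w$ of $S$, the subset $a\langle w\rangle b = \{ a w^n b \mid n \ge 0\}$ (with $w^0 = 1$) is called a sandwich. Every singleton $\{a\} = a\langle 1\rangle 1$ is a sandwich. A sandwich $a\langle w \rangle b$ is called free if its elements $a w^n b$ are pairwise different for all $n \ge 0$. At most linear growth: for a finite generating set of $S$, the number of elements of $S$ that can be represented by words of length at most $n$ in the generators is $O(n)$ as $n \to \infty$ (this does not depend on the choice of the finite generating set). *)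

theory Defs
  imports Complex_Main "HOL-Library.Landau_Symbols" "HOL-Library.Disjoint_Sets"
begin

text \<open>
  The monoid \<open>S\<close> is a type of class \<^class>\<open>monoid_mult\<close>; predicates on \<open>S\<close> itself take the
  argument \<open>TYPE('a)\<close>.  A zero is not part of the signature: \<open>S\<close> may or may not contain one.
\<close>

definition is_zero :: "'a::monoid_mult \<Rightarrow> bool" where
  "is_zero z \<longleftrightarrow> (\<forall>x. z * x = z \<and> x * z = z)"

definition has_zero :: "'a::monoid_mult itself \<Rightarrow> bool" where
  "has_zero S \<longleftrightarrow> (\<exists>z::'a. is_zero z)"

text \<open>
  \<open>Some w\<close> is a word \<open>w\<close> in the generators, and \<open>None\<close> is the symbol \<open>0\<close>.  The symbol \<open>0\<close> is
  available exactly when \<open>S\<close> contains a zero, so \<open>free_words X\<close> is the free monoid with zero on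
  \<open>X\<close> in that case, and the free monoid on \<open>X\<close> otherwise.  Generators are elements of \<open>S\<close>,
  and \<open>0\<close> need not be a product of generators.
\<close>

type_synonym 'a pword = "'a list option"

definition free_words :: "'a::monoid_mult set \<Rightarrow> 'a pword set" where
  "free_words X = Some ` lists X \<union> (if has_zero TYPE('a) then {None} else {})"

fun pword_mult :: "'a pword \<Rightarrow> 'a pword \<Rightarrow> 'a pword" where
  "pword_mult (Some u) (Some v) = Some (u @ v)"
| "pword_mult None _ = None"
| "pword_mult _ None = None"

text \<open>The value of \<open>None\<close> is meaningful only if \<open>S\<close> has a zero, which is then unique.\<close>

fun pword_eval :: "'a::monoid_mult pword \<Rightarrow> 'a" where
  "pword_eval (Some w) = prod_list w"
| "pword_eval None = (THE z. is_zero z)"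

text \<open>The congruence on \<open>free_words X\<close> generated by \<open>R\<close>, for \<open>R \<subseteq> free_words X \<times> free_words X\<close>.\<close>

inductive pres_cong :: "'a::monoid_mult set \<Rightarrow> ('a pword \<times> 'a pword) set \<Rightarrow> 'a pword \<Rightarrow> 'a pword \<Rightarrow> bool"
  for X R where
  rel: "(p, q) \<in> R \<Longrightarrow> pres_cong X R p q"
| refl: "p \<in> free_words X \<Longrightarrow> pres_cong X R p p"
| sym: "pres_cong X R p q \<Longrightarrow> pres_cong X R q p"
| trans: "pres_cong X R p q \<Longrightarrow> pres_cong X R q r \<Longrightarrow> pres_cong X R p r"
| mult: "pres_cong X R p q \<Longrightarrow> pres_cong X R p' q' \<Longrightarrow>
    pres_cong X R (pword_mult p p') (pword_mult q q')"

definition presentation :: "'a::monoid_mult set \<Rightarrow> ('a pword \<times> 'a pword) set \<Rightarrow> bool" where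
  "presentation X R \<longleftrightarrow>
     R \<subseteq> free_words X \<times> free_words X \<and>
     pword_eval ` free_words X = UNIV \<and>
     (\<forall>p\<in>free_words X. \<forall>q\<in>free_words X. pword_eval p = pword_eval q \<longleftrightarrow> pres_cong X R p q)"

definition finitely_presented :: "'a::monoid_mult itself \<Rightarrow> bool" where
  "finitely_presented S \<longleftrightarrow>
     (\<exists>(X :: 'a set) R. finite X \<and> finite R \<and> presentation X R)"

definition word_degree :: "('a \<Rightarrow> nat) \<Rightarrow> 'a list \<Rightarrow> nat" where
  "word_degree d w = sum_list (map d w)"

definition homogeneous_relation :: "('a \<Rightarrow> nat) \<Rightarrow> 'a pword \<times> 'a pword \<Rightarrow> bool" where
  "homogeneous_relation d r \<longleftrightarrow>
     (\<exists>w. r = (Some w, None)) \<or>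
     (\<exists>w u. r = (Some w, Some u) \<and> word_degree d w = word_degree d u)"

text \<open>The presentation witnessing homogeneity need not be finite.\<close>

definition homogeneous :: "'a::monoid_mult itself \<Rightarrow> bool" where
  "homogeneous S \<longleftrightarrow>
     (\<exists>(X :: 'a set) R d. presentation X R \<and> (\<forall>x\<in>X. 0 < d x) \<and>
        (\<forall>r\<in>R. homogeneous_relation d r))"

definition sandwich :: "'a::monoid_mult \<Rightarrow> 'a \<Rightarrow> 'a \<Rightarrow> 'a set" where
  "sandwich a w b = {a * w ^ n * b | n. True}"

definition is_sandwich :: "'a::monoid_mult set \<Rightarrow> bool" where
  "is_sandwich U \<longleftrightarrow> (\<exists>a w b. U = sandwich a w b)"

definition is_free_sandwich :: "'a::monoid_mult set \<Rightarrow> bool" where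
  "is_free_sandwich U \<longleftrightarrow> (\<exists>a w b. U = sandwich a w b \<and> inj (\<lambda>n::nat. a * w ^ n * b))"

text \<open>
  Here \<open>X\<close> generates \<open>S\<close> as a plain monoid; if \<open>S\<close> has a zero that is not a product of other
  generators, it belongs to \<open>X\<close>.
\<close>

definition at_most_linear_growth :: "'a::monoid_mult itself \<Rightarrow> bool" where
  "at_most_linear_growth S \<longleftrightarrow>
     (\<exists>X :: 'a set. finite X \<and> prod_list ` lists X = UNIV \<and>
        (\<lambda>n. real (card (prod_list ` {w \<in> lists X. length w \<le> n}))) \<in> O(\<lambda>n. real n))"

end

theory Submission
  imports Defs
begin

text \<open>
  Linear growth gives sandwiches by combinatorics on words: the shortlex normal words form a
  factor-closed language, and linear growth yields a length \<open>m\<close> with at most \<open>C \<le> m / 2\<close> normal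
  words of length \<open>m\<close>.  Then every normal word is \<open>a v\<^sup>k b\<close> with \<open>a\<close>, \<open>v\<close>, \<open>b\<close> of bounded length.

  If \<open>S\<close> is a finite union of sandwiches, there is a bounded number of nonzero elements in each
  degree.  As the relations have bounded degree, left multiplication by generators in a sufficiently
  long window of degrees determines it in all larger degrees.  By the pigeonhole principle two
  windows at distance \<open>p\<close> are isomorphic, which gives an injection \<open>\<Phi>\<close> on the nonzero elements of
  large degree that raises the degree by \<open>p\<close> and commutes with left multiplication.  Each sequence
  \<open>a w\<^sup>j b\<close> is eventually compatible with a power of \<open>\<Phi>\<close>, so the orbits of a common power
  \<open>\<Phi>\<^sup>Q\<close>, starting in a window of length \<open>Q p\<close>, are pairwise disjoint free sandwiches.
\<close>

section \<open>Words over a language of low complexity\<close>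

lemma periodic_list_decomp:
  assumes "length v = q" "0 < q" "\<And>t. t < length P \<Longrightarrow> P ! t = v ! (t mod q)"
  shows "\<exists>k b. P = concat (replicate k v) @ b \<and> length b < q"
  using assms(3)
proof (induction "length P" arbitrary: P rule: less_induct)
  case less
  show ?case
  proof (cases "length P < q")
    case True
    then show ?thesis by (intro exI[of _ 0] exI[of _ P]) simp
  next
    case False
    have "drop q P ! t = v ! (t mod q)" if "t < length (drop q P)" for t
      using less.prems[of "q + t"] that False by simp
    then obtain k b where kb: "drop q P = concat (replicate k v) @ b" "length b < q"
      using less.hyps[of "drop q P"] False assms(2)
      by (metis diff_less le_zero_eq length_drop not_le)
    have "take q P = v"
      using False assms less.prems by (intro nth_equalityI) auto
    then have "P = v @ drop q P"
      by (metis append_take_drop_id)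
    then have "P = concat (replicate (Suc k) v) @ b"
      using kb by simp
    then show ?thesis using kb by blast
  qed
qed

lemma nth_mod_period:
  assumes "0 < q" "\<And>t. t + q < length P \<Longrightarrow> P ! t = P ! (t + q)" "t < length P"
  shows "P ! t = P ! (t mod q)"
  using assms(3)
proof (induction t rule: less_induct)
  case (less t)
  show ?case
  proof (cases "t < q")
    case False
    then have "P ! t = P ! (t - q)"
      using assms(2)[of "t - q"] less.prems by simp
    also have "\<dots> = P ! ((t - q) mod q)"
      using less.IH[of "t - q"] less.prems False assms(1) by simp
    finally show ?thesis using False by (simp add: le_mod_geq)
  qed simp
qed

text \<open>
  Two equal factors of length \<open>m\<close> near the beginning of \<open>W\<close> start a run of period \<open>q \<le> C\<close>.
  The windows of length \<open>m\<close> around the position where the run breaks are pairwise different, and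
  there would be more than \<open>C\<close> of them if \<open>m\<close> letters were left after the break.
\<close>

lemma low_complexity_word:
  fixes L :: "'b list set"
  assumes factor: "\<And>x u y. x @ u @ y \<in> L \<Longrightarrow> u \<in> L"
    and fin: "finite {u \<in> L. length u = m}"
    and card: "card {u \<in> L. length u = m} \<le> C"
    and C: "2 * C \<le> m" and W: "W \<in> L"
  shows "\<exists>a v b k. W = a @ concat (replicate k v) @ b \<and>
           length a \<le> 2 * m \<and> length v \<le> 2 * m \<and> length b \<le> 2 * m"
proof (cases "length W < m + C")
  case True
  then show ?thesis
    using C by (intro exI[of _ W] exI[of _ "[]"] exI[of _ 0]) simp
next
  case False
  define f where "f j = take m (drop j W)" for j
  have f_in: "f j \<in> {u \<in> L. length u = m}" if "j + m \<le> length W" for j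
  proof -
    have "W = take j W @ f j @ drop m (drop j W)"
      unfolding f_def by (metis append_take_drop_id)
    then have "f j \<in> L" using factor W by metis
    then show ?thesis using that by (simp add: f_def)
  qed
  have f_nth: "f j ! t = W ! (j + t)" if "j + m \<le> length W" "t < m" for j t
    using that by (simp add: f_def)
  \<comment> \<open>There are \<open>C + 1\<close> starting positions but at most \<open>C\<close>
    words of length \<open>m\<close> in \<open>L\<close>, so two of these windows coincide.\<close>
  have "\<not> inj_on f {0..C}"
  proof
    assume "inj_on f {0..C}"
    then have "card {0..C} \<le> card {u \<in> L. length u = m}"
      using f_in False by (intro card_inj_on_le[OF _ _ fin]) auto
    then show False using card by simp
  qed
  then obtain i j where ij: "i < j" "j \<le> C" "f i = f j"
    unfolding inj_on_def by (metis atLeastAtMost_iff linorder_neqE_nat)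
  define q where "q = j - i"
  have q: "0 < q" "q \<le> C" using ij by (auto simp: q_def)
  have i: "i \<le> C" using ij by simp
  have per0: "W ! (i + t) = W ! (i + t + q)" if "t < m" for t
    using f_nth[of i t] f_nth[of j t] ij that False by (simp add: q_def add.commute)
  \<comment> \<open>\<open>e\<close> is the end of the run of period \<open>q\<close> starting at
    \<open>i\<close>: the first position whose letter differs from the one \<open>q\<close> places
    before it, or \<open>length W\<close> if there is none.\<close>
  obtain e where e: "i + q \<le> e" "e \<le> length W" "length W < e + m"
    "\<And>t. i \<le> t \<Longrightarrow> t + q < e \<Longrightarrow> W ! t = W ! (t + q)"
  proof (cases "\<exists>t. i \<le> t \<and> t + q < length W \<and> W ! t \<noteq> W ! (t + q)")
    case no: False
    show ?thesis
    proof (rule that[of "length W"])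
      show "i + q \<le> length W" using False i q C by simp
      show "length W < length W + m" using C q by simp
    qed (use no in auto)
  next
    case True
    define t0 where "t0 = (LEAST t. i \<le> t \<and> t + q < length W \<and> W ! t \<noteq> W ! (t + q))"
    have t0: "i \<le> t0" "t0 + q < length W" "W ! t0 \<noteq> W ! (t0 + q)"
      using LeastI_ex[OF True] unfolding t0_def by auto
    have least: "W ! t = W ! (t + q)" if "i \<le> t" "t < t0" for t
      using not_less_Least[of t "\<lambda>t. i \<le> t \<and> t + q < length W \<and> W ! t \<noteq> W ! (t + q)"] that t0
      unfolding t0_def[symmetric] by auto
    have t0m: "i + m \<le> t0"
    proof (rule ccontr)
      assume "\<not> i + m \<le> t0"
      then have "t0 - i < m" using t0(1) by linarith
      then show False using per0[of "t0 - i"] t0 by simp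
    qed
    define e where "e = t0 + q"
    have "length W < e + m"
    proof (rule ccontr)
      assume far: "\<not> length W < e + m"
      \<comment> \<open>The window at \<open>e - s\<close> contains \<open>e\<close>, and also
        \<open>e - q\<close> because \<open>q \<le> C \<le> s\<close>. Equality would copy these two
        letters to places \<open>d\<close> further left, where the run still has period
        \<open>q\<close>, so they would agree and there would be no break at
        \<open>e\<close>.\<close>
      have neq: "f (e - s) \<noteq> f (e - s')" if s: "C \<le> s" "s < s'" "s' \<le> m" for s s'
      proof
        assume eq: "f (e - s) = f (e - s')"
        define d where "d = s' - s"
        have shift: "W ! (e - s + t) = W ! (e - s' + t)" if "t < m" for t
          using eq f_nth[of "e - s" t] f_nth[of "e - s'" t] that far s t0m by (simp add: e_def)
        have ix: "e - s + s = e" "e - s' + s = e - d" "e - s + (s - q) = e - q"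
          "e - s' + (s - q) = e - d - q" "e - d - q + q = e - d" "i \<le> e - d - q" "e - d - q < t0"
          "s < m" "s - q < m"
          using s t0m q C unfolding e_def d_def by linarith+
        have "W ! e = W ! (e - d)"
          using shift[of s] ix by simp
        also have "\<dots> = W ! (e - d - q)"
          using least[of "e - d - q"] ix by simp
        also have "\<dots> = W ! (e - q)"
          using shift[of "s - q"] ix by simp
        finally show False using t0 by (simp add: e_def)
      qed
      have "inj_on (\<lambda>s. f (e - s)) {C..m}"
        unfolding inj_on_def by (metis atLeastAtMost_iff linorder_neqE_nat neq)
      then have "card {C..m} \<le> card {u \<in> L. length u = m}"
        using f_in far t0m by (intro card_inj_on_le[OF _ _ fin]) (auto simp: e_def)
      then show False using card C by simp
    qed
    then show ?thesis
      using that[of e] t0 least by (auto simp: e_def)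
  qed
  define P where "P = take (e - i) (drop i W)"
  have lenP: "length P = e - i" using e by (simp add: P_def)
  have "P ! t = P ! (t + q)" if "t + q < length P" for t
    using e(4)[of "i + t"] that e by (simp add: P_def add.assoc)
  note P_mod = nth_mod_period[OF q(1) this]
  have "P ! t = take q P ! (t mod q)" if "t < length P" for t
    using P_mod[OF _ that] q by simp
  moreover have "length (take q P) = q" using lenP e by simp
  ultimately obtain k b where kb: "P = concat (replicate k (take q P)) @ b" "length b < q"
    using periodic_list_decomp[of "take q P" q P] q by blast
  have "W = take i W @ P @ drop e W"
  proof -
    have "drop e W = drop (e - i) (drop i W)" using e by simp
    then show ?thesis unfolding P_def by (simp only: append_take_drop_id)
  qed
  then have "W = take i W @ concat (replicate k (take q P)) @ (b @ drop e W)"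
    using kb by (metis append.assoc)
  then show ?thesis
    using i q C kb(2) e
    by (intro exI[of _ "take i W"] exI[of _ "take q P"] exI[of _ "b @ drop e W"] exI[of _ k]) auto
qed

text \<open>If every length from \<open>2 * (c + 1)\<close> on had at least \<open>c + 2\<close>
  words, the cumulative count would grow with slope \<open>c + 2\<close> and overtake
  \<open>c * n\<close>. The lower bound on \<open>m\<close> is the hypothesis
  \<open>2 * C \<le> m\<close> of \<open>low_complexity_word\<close> for
  \<open>C = c + 1\<close>.\<close>

lemma linear_count_imp_low_complexity:
  fixes L :: "'b list set" and c :: nat
  assumes fin: "\<And>n. finite {u \<in> L. length u \<le> n}"
    and count: "\<And>n. n0 \<le> n \<Longrightarrow> card {u \<in> L. length u \<le> n} \<le> c * n"
  shows "\<exists>m. card {u \<in> L. length u = m} \<le> c + 1 \<and> 2 * (c + 1) \<le> m"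
proof (rule ccontr)
  assume "\<not> ?thesis"
  then have big: "c + 2 \<le> card {u \<in> L. length u = m}" if "2 * c + 2 \<le> m" for m
    using that by (force simp: not_le Suc_le_eq)
  define n where "n = n0 + (2 * c + 2) * (c + 2)"
  have "(\<Sum>m\<in>{2*c+2..n}. c + 2) \<le> (\<Sum>m\<in>{2*c+2..n}. card {u \<in> L. length u = m})"
    by (intro sum_mono big) simp
  also have "\<dots> = card (\<Union>m\<in>{2*c+2..n}. {u \<in> L. length u = m})"
    by (subst card_UN_disjoint) (auto intro: finite_subset[OF _ fin])
  also have "\<dots> \<le> card {u \<in> L. length u \<le> n}"
    by (intro card_mono fin) auto
  also have "\<dots> \<le> c * n" by (intro count) (simp add: n_def)
  finally have *: "(n + 1 - (2 * c + 2)) * (c + 2) \<le> c * n" by simp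
  define k where "k = n0 + (2 * c + 2) * (c + 1) + 1"
  have k: "n + 1 = k + (2 * c + 2)" by (simp add: n_def k_def algebra_simps)
  have "k * (c + 2) \<le> c * n" using * k by simp
  then have "(n + 1) * (c + 2) \<le> c * n + (2 * c + 2) * (c + 2)"
    using k by (simp add: algebra_simps)
  moreover have "(2 * c + 2) * (c + 2) \<le> n" by (simp add: n_def)
  ultimately show False by (simp add: algebra_simps)
qed

section \<open>Shortlex normal forms and the passage from linear growth to sandwiches\<close>

lemma prod_list_concat_replicate:
  "prod_list (concat (replicate k v)) = prod_list v ^ k"
  for v :: "'a::monoid_mult list"
  by (induction k) auto

text \<open>Every element has exactly one shortlex-least word. The set \<open>L\<close> of these
  words is closed under factors because the order is compatible with concatenation on both sides, so
  \<open>low_complexity_word\<close> applies to it.\<close>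

lemma linear_growth_imp_sandwiches:
  assumes "at_most_linear_growth TYPE('a::monoid_mult)"
  shows "\<exists>\<U> :: 'a set set. finite \<U> \<and> (\<forall>U\<in>\<U>. is_sandwich U) \<and> UNIV = \<Union>\<U>"
proof -
  obtain X :: "'a set" where X: "finite X" "prod_list ` lists X = UNIV"
    and O: "(\<lambda>n. real (card (prod_list ` {w \<in> lists X. length w \<le> n}))) \<in> O(\<lambda>n. real n)"
    using assms unfolding at_most_linear_growth_def by blast
  obtain c :: real where "\<forall>\<^sub>F n in sequentially.
      norm (real (card (prod_list ` {w \<in> lists X. length w \<le> n}))) \<le> c * norm (real n)"
    using landau_o.bigE[OF O] by blast
  then obtain n0 where n0: "\<And>n. n0 \<le> n \<Longrightarrow>
      real (card (prod_list ` {w \<in> lists X. length w \<le> n})) \<le> c * real n"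
    unfolding eventually_sequentially by auto
  define c' where "c' = nat \<lceil>c\<rceil>"
  have c': "c \<le> real c'" unfolding c'_def by linarith
  obtain r :: "'a rel" where r: "well_order_on UNIV r"
    using well_order_on[of "UNIV :: 'a set"] by (elim exE)
  define lt where "lt = lenlex (r - Id)"
  have wf: "wf lt"
    unfolding lt_def
  proof (rule wf_lenlex)
    show "wf (r - Id)" using r unfolding well_order_on_def by simp
  qed
  have tot: "total lt"
    unfolding lt_def
  proof (rule total_lenlex)
    show "total (r - Id)"
      using r unfolding well_order_on_def linear_order_on_def by (simp add: total_on_diff_Id)
  qed
  define L where "L = {w \<in> lists X. \<forall>u\<in>lists X. prod_list u = prod_list w \<longrightarrow> (u, w) \<notin> lt}"
  have fin_le: "finite {w \<in> lists X. length w \<le> n}" for n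
    by (rule finite_subset[OF _ finite_lists_length_le[OF X(1), of n]]) auto
  have finL: "finite {w \<in> L. length w \<le> n}" for n
    by (rule finite_subset[OF _ fin_le[of n]]) (auto simp: L_def)
  have inj: "inj_on prod_list L"
  proof (rule inj_onI, rule ccontr)
    fix u w assume uw: "u \<in> L" "w \<in> L" "prod_list u = prod_list w" "u \<noteq> w"
    then have "(u, w) \<in> lt \<or> (w, u) \<in> lt" using tot by (simp add: total_on_def)
    then show False using uw by (auto simp: L_def)
  qed
  have factor: "u \<in> L" if "x @ u @ y \<in> L" for x u y
  proof -
    have "(u', u) \<notin> lt" if u': "u' \<in> lists X" "prod_list u' = prod_list u" for u'
    proof
      assume "(u', u) \<in> lt"
      then have "(x @ u' @ y, x @ u @ y) \<in> lt"
        unfolding lt_def by (simp add: lenlex_append1 irrefl_def)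
      moreover have "x @ u' @ y \<in> lists X" "prod_list (x @ u' @ y) = prod_list (x @ u @ y)"
        using u' \<open>x @ u @ y \<in> L\<close> by (simp_all add: L_def)
      ultimately show False
        using \<open>x @ u @ y \<in> L\<close> unfolding L_def by blast
    qed
    moreover have "u \<in> lists X" using that by (simp add: L_def)
    ultimately show ?thesis by (simp add: L_def)
  qed
  have rep: "\<exists>w\<in>L. prod_list w = s" for s
  proof -
    define A where "A = {w \<in> lists X. prod_list w = s}"
    have "s \<in> prod_list ` lists X" using X(2) by simp
    then obtain w0 where "w0 \<in> A" by (auto simp: A_def)
    then obtain w where "w \<in> A" "\<And>u. (u, w) \<in> lt \<Longrightarrow> u \<notin> A"
      using wfE_min[OF wf] by blast
    then show ?thesis by (intro bexI[of _ w]) (auto simp: L_def A_def)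
  qed
  have count: "card {w \<in> L. length w \<le> n} \<le> c' * n" if "n0 \<le> n" for n
  proof -
    have "card {w \<in> L. length w \<le> n} \<le> card (prod_list ` {w \<in> lists X. length w \<le> n})"
      using inj fin_le by (intro card_inj_on_le[of prod_list])
        (auto simp: L_def intro: inj_on_subset)
    also have "real \<dots> \<le> c * real n" by (rule n0[OF that])
    also have "\<dots> \<le> real c' * real n" by (intro mult_right_mono c') simp
    finally show ?thesis by (simp flip: of_nat_mult)
  qed
  obtain m where m: "card {u \<in> L. length u = m} \<le> c' + 1" "2 * (c' + 1) \<le> m"
    using linear_count_imp_low_complexity[OF finL count] by blast
  define B where "B = {w \<in> lists X. length w \<le> 2 * m}"
  define \<U> where "\<U> = (\<lambda>(a, v, b). sandwich (prod_list a) (prod_list v) (prod_list b)) ` (B \<times> B \<times> B)"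
  have "s \<in> \<Union>\<U>" for s
  proof -
    obtain w where w: "w \<in> L" "prod_list w = s" using rep by blast
    have "finite {u \<in> L. length u = m}"
      by (rule finite_subset[OF _ finL[of m]]) auto
    then have "\<exists>a v b k. w = a @ concat (replicate k v) @ b \<and>
        length a \<le> 2 * m \<and> length v \<le> 2 * m \<and> length b \<le> 2 * m"
      using m w(1) by (intro low_complexity_word[where L = L and C = "c' + 1"]) (auto intro: factor)
    then obtain a v b k where d: "w = a @ concat (replicate k v) @ b"
      "length a \<le> 2 * m" "length v \<le> 2 * m" "length b \<le> 2 * m"
      by blast
    \<comment> \<open>For \<open>k = 0\<close> nothing places the letters of \<open>v\<close> in
      \<open>X\<close>, so the empty word replaces it.\<close>
    define v' where "v' = (if k = 0 then [] else v)"
    have d': "w = a @ concat (replicate k v') @ b" using d by (simp add: v'_def)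
    have "a \<in> B" "v' \<in> B" "b \<in> B"
      using w d unfolding L_def B_def v'_def by (auto simp: in_lists_conv_set)
    moreover have "s = prod_list a * prod_list v' ^ k * prod_list b"
      using w(2) unfolding d' by (simp add: prod_list_concat_replicate mult.assoc)
    ultimately show ?thesis
      unfolding \<U>_def sandwich_def by blast
  qed
  moreover have "finite \<U>" unfolding \<U>_def B_def using fin_le by simp
  moreover have "\<forall>U\<in>\<U>. is_sandwich U" unfolding \<U>_def is_sandwich_def by auto
  ultimately show ?thesis by blast
qed

section \<open>The degree function\<close>

lemma is_zero_unique: "is_zero z \<Longrightarrow> is_zero z' \<Longrightarrow> z = z'"
  unfolding is_zero_def by metis

lemma is_zero_mult: "is_zero s \<or> is_zero t \<Longrightarrow> is_zero (s * t)"
  unfolding is_zero_def by metis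

lemma is_zero_mult_eq: "is_zero z \<Longrightarrow> z * s = z" "is_zero z \<Longrightarrow> s * z = z"
  unfolding is_zero_def by auto

lemma the_zero: "is_zero z \<Longrightarrow> (THE z. is_zero z) = z"
  using is_zero_unique by blast

lemma Some_in_free_words [simp]: "Some w \<in> free_words X \<longleftrightarrow> w \<in> lists X"
  by (auto simp: free_words_def)

lemma None_in_free_words: "None \<in> free_words (X :: 'a::monoid_mult set) \<longleftrightarrow> has_zero TYPE('a)"
  by (auto simp: free_words_def)

lemma is_zero_eval_None: "None \<in> free_words (X :: 'a::monoid_mult set) \<Longrightarrow> is_zero (pword_eval None :: 'a)"
  using the_zero by (auto simp: None_in_free_words has_zero_def)

lemma pword_mult_in_free_words:
  "p \<in> free_words X \<Longrightarrow> q \<in> free_words X \<Longrightarrow> pword_mult p q \<in> free_words X"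
  by (cases p; cases q) auto

lemma pword_eval_mult:
  assumes "p \<in> free_words X" "q \<in> free_words X"
  shows "pword_eval (pword_mult p q) = pword_eval p * pword_eval q"
  using assms is_zero_eval_None[of X]
  by (cases p; cases q) (auto simp: is_zero_mult_eq simp del: pword_eval.simps(2))

lemma pres_cong_free_words:
  assumes "R \<subseteq> free_words X \<times> free_words X" "pres_cong X R p q"
  shows "p \<in> free_words X \<and> q \<in> free_words X"
  using assms(2,1) by (induction rule: pres_cong.induct) (auto intro: pword_mult_in_free_words)

lemma presentation_eval_eq:
  assumes "presentation X R" "pres_cong X R p q"
  shows "pword_eval p = pword_eval q"
  using assms pres_cong_free_words unfolding presentation_def by blast

lemma presentation_nonzero_word:
  assumes "presentation X R" "\<not> is_zero s"
  obtains w where "w \<in> lists X" "prod_list w = s"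
proof -
  have "s \<in> pword_eval ` free_words X" using assms by (simp add: presentation_def)
  then obtain p where p: "p \<in> free_words X" "s = pword_eval p" by blast
  then obtain w where "p = Some w" using assms(2) is_zero_eval_None[of X] by (cases p) auto
  then show ?thesis using p that by simp
qed

lemma word_degree_append [simp]: "word_degree d (u @ v) = word_degree d u + word_degree d v"
  by (simp add: word_degree_def)

lemma word_degree_Nil [simp]: "word_degree d [] = 0"
  by (simp add: word_degree_def)

lemma word_degree_Cons [simp]: "word_degree d (x # v) = d x + word_degree d v"
  by (simp add: word_degree_def)

text \<open>Each defining relation has value zero or equates words of equal degree, and both
  alternatives survive the closure rules, since a zero factor makes a product zero. The first
  alternative speaks of the value because a word, too, may represent zero.\<close>

lemma pres_cong_homogeneous:
  assumes pres: "presentation X R" and hom: "\<forall>r\<in>R. homogeneous_relation d r"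
    and "pres_cong X R p q"
  shows "is_zero (pword_eval p) \<or> (\<exists>u v. p = Some u \<and> q = Some v \<and> word_degree d u = word_degree d v)"
  using assms(3)
proof (induction rule: pres_cong.induct)
  case (rel p q)
  have "pword_eval p = pword_eval q" by (rule presentation_eval_eq[OF pres pres_cong.rel[OF rel]])
  moreover have "q \<in> free_words X" using pres rel unfolding presentation_def by auto
  ultimately show ?case
    using bspec[OF hom rel] is_zero_eval_None[of X] by (auto simp: homogeneous_relation_def)
next
  case (refl p)
  then show ?case using is_zero_eval_None[of X] by (cases p) auto
next
  case (sym p q)
  then show ?case using presentation_eval_eq[OF pres sym.hyps] by auto
next
  case (trans p q r)
  then show ?case using presentation_eval_eq[OF pres trans.hyps(1)] by auto
next
  case (mult p q p' q')
  have fw: "p \<in> free_words X" "p' \<in> free_words X"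
    using mult.hyps pres_cong_free_words pres unfolding presentation_def by blast+
  show ?case
    using mult.IH is_zero_mult[of "pword_eval p" "pword_eval p'"] pword_eval_mult[OF fw] by auto
qed

text \<open>The value of \<open>\<delta>\<close> at the zero element, if there is one, is arbitrary.\<close>

locale graded_monoid =
  fixes \<delta> :: "'a::monoid_mult \<Rightarrow> nat"
  assumes deg_mult: "\<not> is_zero (s * t) \<Longrightarrow> \<delta> (s * t) = \<delta> s + \<delta> t"
    and deg_0: "\<not> is_zero s \<Longrightarrow> \<delta> s = 0 \<Longrightarrow> s = 1"

text \<open>The degree of a nonzero element is that of any word for it, well defined by
  \<open>pres_cong_homogeneous\<close>. Attaching degrees to elements instead of words frees them
  from the homogeneous presentation, so the finite presentation used later may be a different
  one.\<close>

lemma homogeneous_imp_graded: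
  assumes "homogeneous TYPE('a::monoid_mult)"
  shows "\<exists>\<delta> :: 'a \<Rightarrow> nat. graded_monoid \<delta>"
proof -
  obtain X :: "'a set" and R d where pres: "presentation X R"
    and d: "\<And>x. x \<in> X \<Longrightarrow> 0 < d x" and hom: "\<forall>r\<in>R. homogeneous_relation d r"
    using assms unfolding homogeneous_def by blast
  define word where "word s = (SOME w. w \<in> lists X \<and> prod_list w = s)" for s
  define \<delta> where "\<delta> s = word_degree d (word s)" for s
  have word: "word s \<in> lists X" "prod_list (word s) = s" if nz: "\<not> is_zero s" for s
  proof -
    have "word s \<in> lists X \<and> prod_list (word s) = s"
      unfolding word_def
      by (rule someI_ex) (meson presentation_nonzero_word[OF pres nz])
    then show "word s \<in> lists X" "prod_list (word s) = s" by auto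
  qed
  have deg: "\<delta> (prod_list w) = word_degree d w"
    if "w \<in> lists X" "\<not> is_zero (prod_list w)" for w
  proof -
    have cong: "pres_cong X R (Some w) (Some (word (prod_list w)))"
      using pres word[OF that(2)] that unfolding presentation_def by force
    show ?thesis
      using pres_cong_homogeneous[OF pres hom cong] that by (auto simp: \<delta>_def)
  qed
  have "graded_monoid \<delta>"
  proof
    fix s t :: 'a
    assume nz: "\<not> is_zero (s * t)"
    then have st: "\<not> is_zero s" "\<not> is_zero t" using is_zero_mult by blast+
    have "\<delta> (prod_list (word s @ word t)) = word_degree d (word s @ word t)"
      using nz word[OF st(1)] word[OF st(2)] by (intro deg) auto
    then show "\<delta> (s * t) = \<delta> s + \<delta> t"
      using word[OF st(1)] word[OF st(2)] by (simp add: \<delta>_def)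
  next
    fix s :: 'a
    assume s: "\<not> is_zero s" "\<delta> s = 0"
    then have "word s = []"
      using word[OF s(1)] d by (cases "word s") (fastforce simp: \<delta>_def)+
    then show "s = 1" using word(2)[OF s(1)] by simp
  qed
  then show ?thesis by blast
qed

section \<open>Counting elements by degree, and linear growth from sandwiches\<close>

context graded_monoid
begin

abbreviation homog :: "nat \<Rightarrow> 'a set" where
  "homog n \<equiv> {s. \<not> is_zero s \<and> \<delta> s = n}"

lemma nonzero_factors:
  assumes "\<not> is_zero (s * t)"
  shows "\<not> is_zero s" "\<not> is_zero t"
  using assms is_zero_mult by blast+

lemma deg_one: "\<not> is_zero (1::'a) \<Longrightarrow> \<delta> 1 = 0"
  using deg_mult[of 1 1] by simp

lemma deg_power: "\<not> is_zero (w ^ n) \<Longrightarrow> \<delta> (w ^ n) = n * \<delta> w"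
proof (induction n)
  case 0
  then show ?case by (simp add: deg_one)
next
  case (Suc n)
  then have "\<not> is_zero (w * w ^ n)" by simp
  then show ?case using Suc nonzero_factors[of w "w ^ n"] by (simp add: deg_mult)
qed

lemma deg_sandwich:
  assumes "\<not> is_zero (a * w ^ n * b)"
  shows "\<delta> (a * w ^ n * b) = \<delta> a + n * \<delta> w + \<delta> b"
proof -
  have "\<not> is_zero (a * w ^ n)" using nonzero_factors[OF assms] by simp
  then have "\<not> is_zero (w ^ n)" using nonzero_factors by blast
  then show ?thesis
    using deg_mult[OF assms] deg_mult[OF \<open>\<not> is_zero (a * w ^ n)\<close>] deg_power by simp
qed

lemma deg_prod_list: "\<not> is_zero (prod_list v) \<Longrightarrow> \<delta> (prod_list v) = word_degree \<delta> v"
proof (induction v)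
  case Nil
  then show ?case by (simp add: deg_one)
next
  case (Cons x v)
  then show ?case using nonzero_factors[of x "prod_list v"] by (simp add: deg_mult)
qed

text \<open>If \<open>\<delta> w\<close> is positive, the degree determines the exponent. Otherwise
  \<open>w\<close> is \<open>1\<close>, or \<open>w\<close> is the zero, whose degree is arbitrary;
  then only exponent 0 can give a nonzero element.\<close>

lemma sandwich_exponent_unique:
  assumes "\<not> is_zero (a * w ^ n * b)" "\<not> is_zero (a * w ^ m * b)"
    and "\<delta> (a * w ^ n * b) = \<delta> (a * w ^ m * b)"
  shows "a * w ^ n * b = a * w ^ m * b"
proof (cases "\<delta> w = 0")
  case False
  then show ?thesis using assms deg_sandwich[OF assms(1)] deg_sandwich[OF assms(2)] by simp
next
  case True
  have zero: "a * w ^ k * b = w" if "is_zero w" "0 < k" for k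
    using that by (cases k) (simp_all add: is_zero_mult_eq)
  show ?thesis
  proof (cases "is_zero w")
    case True
    then show ?thesis using zero assms by (metis gr0I)
  next
    case False
    then have "w = 1" using deg_0 \<open>\<delta> w = 0\<close> by blast
    then show ?thesis by simp
  qed
qed

text \<open>A sandwich has at most one nonzero element in each degree, so choosing a sandwich around
  each element is injective on \<open>homog n\<close>.\<close>

lemma homog_card_bound:
  assumes "finite \<U>" "\<forall>U\<in>\<U>. is_sandwich U" "(UNIV :: 'a set) = \<Union>\<U>"
  shows "finite (homog n) \<and> card (homog n) \<le> card \<U>"
proof -
  define f where "f s = (SOME U. U \<in> \<U> \<and> s \<in> U)" for s
  have f: "f s \<in> \<U>" "s \<in> f s" for s
  proof -
    have "\<exists>U. U \<in> \<U> \<and> s \<in> U" using assms(3) by blast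
    from someI_ex[OF this] show "f s \<in> \<U>" "s \<in> f s" unfolding f_def by auto
  qed
  have "inj_on f (homog n)"
  proof (rule inj_onI)
    fix s t assume st: "s \<in> homog n" "t \<in> homog n" "f s = f t"
    obtain a w b where "f s = sandwich a w b" using f(1)[of s] assms(2) unfolding is_sandwich_def by blast
    then show "s = t" using f(2)[of s] f(2)[of t] st sandwich_exponent_unique
      by (auto simp: sandwich_def)
  qed
  moreover have "f ` homog n \<subseteq> \<U>" using f by blast
  ultimately show ?thesis
    using assms(1) by (meson card_inj_on_le inj_on_finite)
qed

lemma finite_bounded_degree:
  assumes "\<And>n. finite (homog n)"
  shows "finite {s. is_zero s \<or> \<delta> s < n}"
proof -
  have "finite {s :: 'a. is_zero s}"
  proof (cases "\<exists>z :: 'a. is_zero z")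
    case True
    then obtain z :: 'a where "is_zero z" ..
    then have "{s. is_zero s} = {z}" using is_zero_unique by auto
    then show ?thesis by simp
  qed simp
  moreover have "{s. is_zero s \<or> \<delta> s < n} \<subseteq> {s. is_zero s} \<union> (\<Union>m<n. homog m)" by auto
  ultimately show ?thesis
    using assms by (meson finite_UN_I finite_Un finite_lessThan finite_subset)
qed

lemma word_degree_le:
  assumes "\<And>x. x \<in> set v \<Longrightarrow> \<delta> x \<le> D"
  shows "word_degree \<delta> v \<le> length v * D"
  using assms by (induction v) (auto simp: add_mono)

text \<open>The elements \<open>a\<close>, \<open>w\<close>, \<open>b\<close> of the given
  sandwiches generate \<open>S\<close>. A nonzero product of at most \<open>n\<close> of them has
  degree at most \<open>n * D\<close>, and each degree contributes at most \<open>card \<U>\<close>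
  elements.\<close>

lemma sandwiches_imp_linear_growth:
  assumes "finite \<U>" "\<forall>U\<in>\<U>. is_sandwich U" "(UNIV :: 'a set) = \<Union>\<U>"
  shows "at_most_linear_growth TYPE('a)"
proof -
  obtain A W B where U: "\<And>U. U \<in> \<U> \<Longrightarrow> U = sandwich (A U) (W U) (B U)"
    using assms(2) unfolding is_sandwich_def by metis
  define X where "X = A ` \<U> \<union> W ` \<U> \<union> B ` \<U>"
  have "finite X" using assms(1) by (simp add: X_def)
  have gen: "s \<in> prod_list ` lists X" for s
  proof -
    obtain V where V: "V \<in> \<U>" "s \<in> V" using assms(3) by blast
    then obtain n where "s = A V * W V ^ n * B V" using U[OF V(1)] by (auto simp: sandwich_def)
    then have "s = prod_list ([A V] @ replicate n (W V) @ [B V])"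
      by (simp add: mult.assoc)
    moreover have "[A V] @ replicate n (W V) @ [B V] \<in> lists X"
      using V by (auto simp: X_def in_lists_conv_set)
    ultimately show ?thesis by blast
  qed
  define D where "D = Max (insert 0 (\<delta> ` X))"
  have D: "\<delta> x \<le> D" if "x \<in> X" for x using that \<open>finite X\<close> by (simp add: D_def)
  define k where "k = card \<U>"
  note homog = homog_card_bound[OF assms, folded k_def]
  have bound: "card (prod_list ` {w \<in> lists X. length w \<le> n}) \<le> (k * (D + 1) + 1) * n" if "1 \<le> n" for n
  proof -
    have "prod_list ` {w \<in> lists X. length w \<le> n} \<subseteq> {s. is_zero s} \<union> (\<Union>m<Suc (n * D). homog m)"
    proof (intro subsetI, elim imageE)
      fix s w assume s: "s = prod_list w" and w: "w \<in> {w \<in> lists X. length w \<le> n}"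
      have "word_degree \<delta> w \<le> length w * D" using w D by (intro word_degree_le) auto
      also have "\<dots> \<le> n * D" using w by simp
      finally show "s \<in> {s. is_zero s} \<union> (\<Union>m<Suc (n * D). homog m)"
        using deg_prod_list[of w] s by auto
    qed
    moreover have z: "finite {s :: 'a. is_zero s}" "card {s :: 'a. is_zero s} \<le> 1"
      using is_zero_unique finite_bounded_degree[of 0] homog
      by (auto simp: card_le_Suc0_iff_eq)
    ultimately have "card (prod_list ` {w \<in> lists X. length w \<le> n}) \<le>
        card ({s :: 'a. is_zero s} \<union> (\<Union>m<Suc (n * D). homog m))"
      using homog by (intro card_mono) auto
    also have "\<dots> \<le> card {s :: 'a. is_zero s} + card (\<Union>m<Suc (n * D). homog m)"
      by (rule card_Un_le)
    also have "\<dots> \<le> 1 + (\<Sum>m<Suc (n * D). k)"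
      using homog z by (intro add_mono order_trans[OF card_UN_le] sum_mono) auto
    also have "\<dots> = 1 + Suc (n * D) * k" by simp
    also have "\<dots> \<le> n + (n * D + n) * k" using that by (intro add_mono mult_right_mono) auto
    finally show ?thesis by (simp add: algebra_simps)
  qed
  have "(\<lambda>n. real (card (prod_list ` {w \<in> lists X. length w \<le> n}))) \<in> O(\<lambda>n. real n)"
  proof (rule bigoI)
    show "\<forall>\<^sub>F n in sequentially. norm (real (card (prod_list ` {w \<in> lists X. length w \<le> n})))
        \<le> real (k * (D + 1) + 1) * norm (real n)"
      using bound by (intro eventually_sequentiallyI[of 1])
        (simp only: real_norm_def abs_of_nat of_nat_mult[symmetric] of_nat_le_iff)
  qed
  then show ?thesis
    unfolding at_most_linear_growth_def using \<open>finite X\<close> gen by blast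
qed

end

section \<open>Extending a map between degree windows\<close>

text \<open>
  \<open>\<phi>\<close> maps the elements of degree in \<open>{n..<n + D}\<close> compatibly with left multiplication by
  generators.  As no relation is longer than the window, \<open>\<phi>\<close> extends to all degrees \<open>\<ge> n\<close> by
  letting it act on a suffix of a word whose degree lies in the window.
\<close>

locale window_map = graded_monoid \<delta> for \<delta> :: "'a::monoid_mult \<Rightarrow> nat" +
  fixes X :: "'a set" and R :: "('a pword \<times> 'a pword) set" and D n :: nat and \<phi> :: "'a \<Rightarrow> 'a"
  assumes pres: "presentation X R"
    and rel_degree: "\<And>w. Some w \<in> fst ` R \<union> snd ` R \<Longrightarrow> word_degree \<delta> w < D"
    and gen_degree: "\<And>x. x \<in> X \<Longrightarrow> \<delta> x \<le> D"
    and D_pos: "0 < D"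
    and map_zero: "\<And>z. is_zero z \<Longrightarrow> \<phi> z = z"
    and map_mult: "\<And>x s. x \<in> X \<Longrightarrow> \<not> is_zero s \<Longrightarrow> n \<le> \<delta> s \<Longrightarrow> \<delta> x + \<delta> s < n + D \<Longrightarrow>
      \<phi> (x * s) = x * \<phi> s"
begin

primrec push :: "'a list \<Rightarrow> 'a" where
  "push [] = \<phi> 1"
| "push (x # v) =
    (if word_degree \<delta> (x # v) < n + D then \<phi> (prod_list (x # v)) else x * push v)"

lemma push_window: "word_degree \<delta> v < n + D \<Longrightarrow> push v = \<phi> (prod_list v)"
  by (cases v) auto

text \<open>By \<open>map_mult\<close> a letter can be pulled out through \<open>\<phi>\<close>
  inside the window, just as \<open>push\<close> does above it. Hence any suffix of degree at least
  \<open>n\<close> may serve as the place to cut.\<close>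

lemma push_append:
  assumes "u \<in> lists X" "n \<le> word_degree \<delta> v"
  shows "push (u @ v) = prod_list u * push v"
  using assms(1)
proof (induction u)
  case (Cons x u)
  show ?case
  proof (cases "word_degree \<delta> (x # u @ v) < n + D")
    case True
    define s where "s = prod_list (u @ v)"
    have "\<phi> (x * s) = x * \<phi> s"
    proof (cases "is_zero s")
      case True
      then show ?thesis by (simp add: is_zero_mult_eq map_zero)
    next
      case False
      then show ?thesis
        using Cons True assms(2) deg_prod_list[of "u @ v"] by (intro map_mult) (auto simp: s_def)
    qed
    moreover have "push (x # u @ v) = \<phi> (x * s)" using True by (simp add: s_def)
    moreover have "\<phi> s = push (u @ v)"
      using True by (simp add: push_window s_def del: prod_list.append)
    ultimately show ?thesis using Cons by (simp add: mult.assoc)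
  next
    case False
    then have "push (x # u @ v) = x * push (u @ v)" by simp
    then show ?thesis using Cons by (simp add: mult.assoc)
  qed
qed simp

text \<open>Letters have degree at most \<open>D\<close>, so shortening the word from the left
  cannot jump over a window of length \<open>D\<close>. The number \<open>c\<close> stands for the
  degree of a fixed part further right.\<close>

lemma suffix_in_window:
  assumes "x \<in> lists X" "c < n + D" "n \<le> word_degree \<delta> x + c"
  shows "\<exists>x1 x2. x = x1 @ x2 \<and> n \<le> word_degree \<delta> x2 + c \<and> word_degree \<delta> x2 + c < n + D"
  using assms
proof (induction x)
  case (Cons a x)
  show ?case
  proof (cases "n \<le> word_degree \<delta> x + c")
    case True
    then obtain x1 x2 where "x = x1 @ x2" "n \<le> word_degree \<delta> x2 + c" "word_degree \<delta> x2 + c < n + D"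
      using Cons by auto
    then show ?thesis by (intro exI[of _ "a # x1"] exI[of _ x2]) simp
  next
    case False
    have "\<delta> a \<le> D" using gen_degree Cons.hyps by simp
    then show ?thesis
      using False Cons.prems by (intro exI[of _ "[]"] exI[of _ "a # x"]) simp
  qed
qed simp

text \<open>The plain product below degree \<open>n\<close> is a default that lets invariance under
  \<open>pres_cong\<close> be proved without a restriction on degrees.\<close>

definition val :: "'a pword \<Rightarrow> 'a" where
  "val p = (case p of None \<Rightarrow> pword_eval None
     | Some v \<Rightarrow> if n \<le> word_degree \<delta> v then push v else prod_list v)"

lemma val_Some: "val (Some v) = (if n \<le> word_degree \<delta> v then push v else prod_list v)"
  by (simp add: val_def)

lemma val_None: "val None = pword_eval None"
  by (simp add: val_def)

text \<open>As \<open>r\<close> has degree below \<open>D\<close>, the word can be cut at a suffix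
  that contains \<open>r\<close> entirely or avoids it, so only the product of \<open>r\<close>
  matters. The four cases tell in which part the suffixes reach degree \<open>n\<close>, if they
  do.\<close>

lemma val_context:
  assumes x: "x \<in> lists X" and y: "y \<in> lists X" and k: "k < D"
  shows "\<exists>f. (\<forall>z. is_zero z \<longrightarrow> f z = z) \<and>
    (\<forall>r\<in>lists X. word_degree \<delta> r = k \<longrightarrow> val (Some (x @ r @ y)) = f (prod_list r))"
proof -
  consider (y) "n \<le> word_degree \<delta> y"
    | (ry) "word_degree \<delta> y < n" "n \<le> k + word_degree \<delta> y"
    | (xry) "k + word_degree \<delta> y < n" "n \<le> word_degree \<delta> x + (k + word_degree \<delta> y)"
    | (none) "word_degree \<delta> x + (k + word_degree \<delta> y) < n"
    by linarith
  then show ?thesis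
  proof cases
    case y
    have "val (Some (x @ r @ y)) = prod_list x * prod_list r * push y" if "r \<in> lists X" for r
      using push_append[of "x @ r" y] x that y by (simp add: val_Some mult.assoc)
    then show ?thesis
      by (intro exI[of _ "\<lambda>s. prod_list x * s * push y"]) (simp add: is_zero_mult_eq)
  next
    case ry
    have "val (Some (x @ r @ y)) = prod_list x * \<phi> (prod_list r * prod_list y)"
      if "r \<in> lists X" "word_degree \<delta> r = k" for r
      using push_append[of x "r @ y"] push_window[of "r @ y"] x k that ry by (simp add: val_Some)
    then show ?thesis
      by (intro exI[of _ "\<lambda>s. prod_list x * \<phi> (s * prod_list y)"])
        (simp add: is_zero_mult_eq map_zero)
  next
    case xry
    obtain x1 x2 where x12: "x = x1 @ x2" "n \<le> word_degree \<delta> x2 + (k + word_degree \<delta> y)"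
      "word_degree \<delta> x2 + (k + word_degree \<delta> y) < n + D"
      using suffix_in_window[OF x _ xry(2)] xry(1) by auto
    have "val (Some (x @ r @ y)) = prod_list x1 * \<phi> (prod_list x2 * (prod_list r * prod_list y))"
      if "r \<in> lists X" "word_degree \<delta> r = k" for r
      using push_append[of x1 "x2 @ r @ y"] push_window[of "x2 @ r @ y"] x that x12
      by (simp add: val_Some)
    then show ?thesis
      by (intro exI[of _ "\<lambda>s. prod_list x1 * \<phi> (prod_list x2 * (s * prod_list y))"])
        (simp add: is_zero_mult_eq map_zero)
  next
    case none
    then show ?thesis
      by (intro exI[of _ "\<lambda>s. prod_list x * (s * prod_list y)"]) (simp add: is_zero_mult_eq val_Some)
  qed
qed

lemma val_zero_factor:
  assumes "x \<in> lists X" "y \<in> lists X" "r \<in> lists X" "word_degree \<delta> r < D" "is_zero (prod_list r)"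
  shows "val (Some (x @ r @ y)) = prod_list r"
  using val_context[OF assms(1,2,4)] assms(3,5) by metis

text \<open>The context \<open>x\<close>, \<open>y\<close> makes the induction work: in the product
  rule one factor changes at a time, and the other is absorbed into the context.\<close>

lemma val_pres_cong:
  assumes "pres_cong X R p q" "x \<in> lists X" "y \<in> lists X"
  shows "val (pword_mult (Some x) (pword_mult p (Some y))) =
    val (pword_mult (Some x) (pword_mult q (Some y)))"
  using assms
proof (induction arbitrary: x y rule: pres_cong.induct)
  case (rel p q)
  have eq: "pword_eval p = pword_eval q" by (rule presentation_eval_eq[OF pres pres_cong.rel[OF rel(1)]])
  have fw: "p \<in> free_words X" "q \<in> free_words X"
    using pres rel(1) unfolding presentation_def by auto
  have deg: "word_degree \<delta> w < D" if "p = Some w \<or> q = Some w" for w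
    using rel_degree[of w] rel(1) that by force
  show ?case
  proof (cases "is_zero (pword_eval p)")
    case True
    have "val (pword_mult (Some x) (pword_mult r (Some y))) = pword_eval r"
      if "r = p \<or> r = q" for r
    proof (cases r)
      case None
      then show ?thesis by (simp add: val_None)
    next
      case (Some w)
      then show ?thesis
        using val_zero_factor[OF rel(2,3), of w] fw deg True eq that by auto
    qed
    then show ?thesis using eq by auto
  next
    case False
    then obtain u v where uv: "p = Some u" "q = Some v"
      using is_zero_eval_None[of X] fw eq by (cases p; cases q) auto
    \<comment> \<open>No homogeneity of this presentation is assumed: both degrees equal
      \<open>\<delta>\<close> of the common nonzero value.\<close>
    then have "word_degree \<delta> u = word_degree \<delta> v"
      using eq False deg_prod_list[of u] deg_prod_list[of v] by simp
    moreover obtain f where "\<forall>r\<in>lists X. word_degree \<delta> r = word_degree \<delta> u \<longrightarrow>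
        val (Some (x @ r @ y)) = f (prod_list r)"
      using val_context[OF rel(2,3), of "word_degree \<delta> u"] deg uv by blast
    ultimately show ?thesis using uv fw eq by simp
  qed
next
  case (trans p q r)
  then show ?case by metis
next
  case (mult p q p' q')
  have fw: "q \<in> free_words X" "p' \<in> free_words X"
    using mult.hyps pres_cong_free_words pres unfolding presentation_def by blast+
  have "val (pword_mult (Some x) (pword_mult (pword_mult p p') (Some y))) =
      val (pword_mult (Some x) (pword_mult (pword_mult q p') (Some y)))"
  proof (cases p')
    case (Some a)
    then show ?thesis
      using mult.IH(1)[of x "a @ y"] mult.prems fw by (cases p; cases q) auto
  qed (cases p; cases q; simp)
  also have "\<dots> = val (pword_mult (Some x) (pword_mult (pword_mult q q') (Some y)))"
  proof (cases q)
    case (Some a)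
    then show ?thesis
      using mult.IH(2)[of "x @ a" y] mult.prems fw by (cases p'; cases q') auto
  qed simp
  finally show ?case .
qed auto

lemma val_eq:
  assumes "p \<in> free_words X" "q \<in> free_words X" "pword_eval p = pword_eval q"
  shows "val p = val q"
proof -
  have "pres_cong X R p q" using assms pres unfolding presentation_def by blast
  then show ?thesis using val_pres_cong[of p q "[]" "[]"] by (cases p; cases q) auto
qed

definition shift :: "'a \<Rightarrow> 'a" where
  "shift s = val (SOME p. p \<in> free_words X \<and> pword_eval p = s)"

lemma shift_eval:
  assumes "p \<in> free_words X"
  shows "shift (pword_eval p) = val p"
proof -
  define q where "q = (SOME q. q \<in> free_words X \<and> pword_eval q = pword_eval p)"
  have "q \<in> free_words X \<and> pword_eval q = pword_eval p"
    unfolding q_def by (rule someI[of _ p]) (use assms in simp)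
  then show ?thesis using val_eq[of q p] assms unfolding shift_def q_def by simp
qed

lemma shift_zero:
  assumes "is_zero z"
  shows "shift z = z"
proof -
  have "None \<in> free_words X" using assms by (auto simp: None_in_free_words has_zero_def)
  then show ?thesis using shift_eval[of None] the_zero[OF assms] by (simp add: val_None)
qed

lemma shift_mult:
  assumes "is_zero s \<or> n \<le> \<delta> s"
  shows "shift (y * s) = y * shift s"
proof (cases "is_zero s \<or> is_zero y")
  case True
  then show ?thesis by (auto simp: is_zero_mult_eq shift_zero)
next
  case False
  obtain t where t: "t \<in> lists X" "prod_list t = y" using presentation_nonzero_word[OF pres] False by blast
  obtain v where v: "v \<in> lists X" "prod_list v = s" using presentation_nonzero_word[OF pres] False by blast
  have deg: "n \<le> word_degree \<delta> v" using assms False v deg_prod_list[of v] by simp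
  show ?thesis
    using shift_eval[of "Some (t @ v)"] shift_eval[of "Some v"] push_append[OF t(1) deg] t v deg
    by (simp add: val_Some)
qed

lemma shift_window:
  assumes "\<not> is_zero e" "n \<le> \<delta> e" "\<delta> e < n + D"
  shows "shift e = \<phi> e"
proof -
  obtain v where v: "v \<in> lists X" "prod_list v = e" using presentation_nonzero_word[OF pres assms(1)] .
  then show ?thesis
    using assms shift_eval[of "Some v"] push_window[of v] deg_prod_list[of v] by (simp add: val_Some)
qed

lemma factor_in_window:
  assumes "\<not> is_zero s" "n \<le> \<delta> s"
  obtains u e where "s = u * e" "n \<le> \<delta> e" "\<delta> e < n + D"
proof -
  obtain v where v: "v \<in> lists X" "prod_list v = s" using presentation_nonzero_word[OF pres assms(1)] .
  then obtain x1 x2 where x: "v = x1 @ x2" "n \<le> word_degree \<delta> x2" "word_degree \<delta> x2 < n + D"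
    using suffix_in_window[of v 0] assms deg_prod_list[of v] D_pos by auto
  then have "s = prod_list x1 * prod_list x2" using v by simp
  then show ?thesis
    using that assms x deg_prod_list[of x2] nonzero_factors[of "prod_list x1" "prod_list x2"] by auto
qed

text \<open>Write \<open>s = u * e\<close> with \<open>e\<close> in the window. Both extended maps
  commute with left multiplication by \<open>u\<close>, so it suffices that \<open>\<psi>\<close>
  inverts \<open>\<phi>\<close> on \<open>e\<close>. The image is nonzero because the inverse map
  fixes zero.\<close>

lemma shift_inverse:
  assumes psi: "window_map \<delta> X R D (n + p) \<psi>"
    and window: "\<And>e. \<not> is_zero e \<Longrightarrow> n \<le> \<delta> e \<Longrightarrow> \<delta> e < n + D \<Longrightarrow>
      \<not> is_zero (\<phi> e) \<and> \<delta> (\<phi> e) = \<delta> e + p \<and> \<psi> (\<phi> e) = e"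
    and s: "\<not> is_zero s" "n \<le> \<delta> s"
  shows "window_map.shift \<delta> X D (n + p) \<psi> (shift s) = s"
    and "\<not> is_zero (shift s)" and "\<delta> (shift s) = \<delta> s + p"
proof -
  interpret psi: window_map \<delta> X R D "n + p" \<psi> by (rule psi)
  obtain u e where ue: "s = u * e" "n \<le> \<delta> e" "\<delta> e < n + D" using factor_in_window[OF s] .
  have e: "\<not> is_zero e" using nonzero_factors s(1) ue(1) by blast
  note w = window[OF e ue(2,3)]
  have sh: "shift s = u * \<phi> e" using ue shift_mult shift_window[OF e] by simp
  have "psi.shift (shift s) = u * psi.shift (\<phi> e)"
    unfolding sh by (rule psi.shift_mult) (use w ue in simp)
  also have "psi.shift (\<phi> e) = e" using w ue by (subst psi.shift_window) auto
  finally show inverse: "psi.shift (shift s) = s" using ue by simp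
  show nz: "\<not> is_zero (shift s)" using inverse s(1) psi.shift_zero by metis
  show "\<delta> (shift s) = \<delta> s + p"
    using nz sh w deg_mult[of u "\<phi> e"] deg_mult[of u e] s(1) ue(1) by simp
qed

end

section \<open>Periodicity in large degrees\<close>

locale shift_monoid = graded_monoid \<delta> for \<delta> :: "'a::monoid_mult \<Rightarrow> nat" +
  fixes n p :: nat and \<Phi> :: "'a \<Rightarrow> 'a"
  assumes p_pos: "0 < p"
    and shift_zero: "\<And>z. is_zero z \<Longrightarrow> \<Phi> z = z"
    and shift_mult: "\<And>y s. is_zero s \<or> n \<le> \<delta> s \<Longrightarrow> \<Phi> (y * s) = y * \<Phi> s"
    and shift_nonzero: "\<And>s. \<not> is_zero s \<Longrightarrow> n \<le> \<delta> s \<Longrightarrow> \<not> is_zero (\<Phi> s)"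
    and shift_degree: "\<And>s. \<not> is_zero s \<Longrightarrow> n \<le> \<delta> s \<Longrightarrow> \<delta> (\<Phi> s) = \<delta> s + p"
    and shift_inj: "inj_on \<Phi> {s. \<not> is_zero s \<and> n \<le> \<delta> s}"

section \<open>Recurring degree windows and the construction of the shift\<close>

context graded_monoid
begin

text \<open>
  \<open>c\<close> labels the elements of each degree injectively.  The state at \<open>n\<close> records, up to labels, left
  multiplication by generators among the elements of degree in \<open>{n..<n + D}\<close>.
\<close>

definition label_state :: "'a set \<Rightarrow> nat \<Rightarrow> ('a \<Rightarrow> nat) \<Rightarrow> nat \<Rightarrow>
    (nat \<times> nat) set \<times> ('a \<times> nat \<times> nat \<times> nat) set" where
  "label_state X D c n =
     ({(i, c s) | i s. i < D \<and> s \<in> homog (n + i)},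
      {(x, i, c s, c (x * s)) | x i s.
         x \<in> X \<and> i < D \<and> s \<in> homog (n + i) \<and> \<not> is_zero (x * s) \<and> \<delta> x + i < D})"

text \<open>With labels injective in each degree the choice is unique, and equal states make it
  possible. The identity outside the window fixes zero, as \<open>map_zero\<close> demands.\<close>

definition transport :: "nat \<Rightarrow> ('a \<Rightarrow> nat) \<Rightarrow> nat \<Rightarrow> nat \<Rightarrow> 'a \<Rightarrow> 'a" where
  "transport D c m m' s =
     (if \<not> is_zero s \<and> m \<le> \<delta> s \<and> \<delta> s < m + D
      then (SOME t. t \<in> homog (m' + (\<delta> s - m)) \<and> c t = c s) else s)"

lemma transport_zero: "is_zero z \<Longrightarrow> transport D c m m' z = z"
  by (simp add: transport_def)

lemma transport_window:
  assumes state: "label_state X D c m = label_state X D c m'"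
    and s: "s \<in> homog (m + i)" "i < D"
  shows "transport D c m m' s \<in> homog (m' + i)" "c (transport D c m m' s) = c s"
proof -
  have "(i, c s) \<in> fst (label_state X D c m)" using s by (auto simp: label_state_def)
  then have "(i, c s) \<in> fst (label_state X D c m')" using state by simp
  then have "\<exists>t. t \<in> homog (m' + i) \<and> c t = c s" unfolding label_state_def by auto
  from someI_ex[OF this]
  show "transport D c m m' s \<in> homog (m' + i)" "c (transport D c m m' s) = c s"
    using s by (auto simp: transport_def)
qed

lemma transport_eqI:
  assumes state: "label_state X D c m = label_state X D c m'"
    and inj: "\<And>k. inj_on c (homog k)"
    and s: "s \<in> homog (m + i)" "i < D" and t: "t \<in> homog (m' + i)" "c t = c s"
  shows "transport D c m m' s = t"
  using transport_window[OF state s] t inj_onD[OF inj] by metis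

lemma transport_inverse:
  assumes state: "label_state X D c m = label_state X D c m'"
    and inj: "\<And>k. inj_on c (homog k)"
    and s: "s \<in> homog (m + i)" "i < D"
  shows "transport D c m' m (transport D c m m' s) = s"
  using transport_eqI[OF state[symmetric] inj _ s(2) s(1)] transport_window[OF state s] by simp

lemma transport_mult:
  assumes state: "label_state X D c m = label_state X D c m'"
    and inj: "\<And>k. inj_on c (homog k)"
    and x: "x \<in> X" and s: "s \<in> homog (m + i)" and i: "\<delta> x + i < D"
  shows "transport D c m m' (x * s) = x * transport D c m m' s"
proof -
  have iD: "i < D" using i by simp
  note T = transport_window[OF state s iD]
  show ?thesis
  proof (cases "is_zero (x * s)")
    case False
    then have "(x, i, c s, c (x * s)) \<in> snd (label_state X D c m)"
      using x s i by (auto simp: label_state_def)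
    then have "(x, i, c s, c (x * s)) \<in> snd (label_state X D c m')" using state by simp
    then obtain t where t: "t \<in> homog (m' + i)" "c t = c s" "\<not> is_zero (x * t)" "c (x * t) = c (x * s)"
      unfolding label_state_def by auto
    have "transport D c m m' s = t" by (rule transport_eqI[OF state inj s iD t(1,2)])
    moreover have "transport D c m m' (x * s) = x * t"
    proof (rule transport_eqI[OF state inj _ i])
      show "x * s \<in> homog (m + (\<delta> x + i))" using False s deg_mult[OF False] by simp
      show "x * t \<in> homog (m' + (\<delta> x + i))" using t deg_mult[OF t(3)] by simp
    qed (rule t(4))
    ultimately show ?thesis by simp
  next
    case True
    \<comment> \<open>States record only nonzero products. A nonzero product here would be recorded
      at \<open>m'\<close>, hence also at \<open>m\<close>, where the labels identify its factor
      with \<open>s\<close>.\<close>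
    have "is_zero (x * transport D c m m' s)"
    proof (rule ccontr)
      assume nz: "\<not> is_zero (x * transport D c m m' s)"
      then have "(x, i, c (transport D c m m' s), c (x * transport D c m m' s))
          \<in> snd (label_state X D c m')"
        unfolding label_state_def snd_conv mem_Collect_eq using x T i iD by blast
      then have "(x, i, c s, c (x * transport D c m m' s)) \<in> snd (label_state X D c m)"
        using state T by simp
      then obtain t where t: "t \<in> homog (m + i)" "c t = c s" "\<not> is_zero (x * t)"
        unfolding label_state_def by auto
      then have "t = s" using inj_onD[OF inj] s by metis
      then show False using t True by simp
    qed
    then show ?thesis using True transport_zero is_zero_unique by metis
  qed
qed

lemma label_state_repeats:
  assumes "finite X" "\<And>s. \<not> is_zero s \<Longrightarrow> c s < K"
  shows "\<exists>m m'. m < m' \<and> label_state X D c m = label_state X D c m'"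
proof -
  have "range (label_state X D c) \<subseteq>
      Pow ({..<D} \<times> {..<K}) \<times> Pow (X \<times> {..<D} \<times> {..<K} \<times> {..<K})"
    using assms(2) by (auto simp: label_state_def)
  moreover have "finite (Pow ({..<D} \<times> {..<K}) \<times> Pow (X \<times> {..<D} \<times> {..<K} \<times> {..<K}))"
    using assms(1) by auto
  ultimately have "finite (range (label_state X D c))" by (rule finite_subset)
  then have "\<not> inj (label_state X D c)" using finite_imageD infinite_UNIV_nat by blast
  then show ?thesis unfolding inj_def by (metis linorder_neqE_nat)
qed

lemma exists_shift:
  assumes fp: "finitely_presented TYPE('a)"
    and bound: "\<And>k. finite (homog k) \<and> card (homog k) \<le> K"
  shows "\<exists>n p \<Phi>. shift_monoid \<delta> n p \<Phi>"
proof -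
  obtain X :: "'a set" and R where fin: "finite X" "finite R" and pres: "presentation X R"
    using fp unfolding finitely_presented_def by blast
  have "\<exists>f. f ` homog k \<subseteq> {..<K} \<and> inj_on f (homog k)" for k
    using bound[of k] by (intro card_le_inj) auto
  then obtain f where f: "\<And>k. f k ` homog k \<subseteq> {..<K}" "\<And>k. inj_on (f k) (homog k)"
    by metis
  define c where "c s = f (\<delta> s) s" for s
  have inj: "inj_on c (homog k)" for k
    using f(2)[of k] by (auto simp: inj_on_def c_def)
  have c_less: "c s < K" if "\<not> is_zero s" for s
    using f(1)[of "\<delta> s"] that by (auto simp: c_def)
  define rels where "rels = {w. Some w \<in> fst ` R \<union> snd ` R}"
  have "finite rels"
    unfolding rels_def using fin by (intro finite_vimageI[of _ Some, unfolded vimage_def]) auto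
  \<comment> \<open>The window must be longer than all relations and generators, measured by degree;
    the successor makes these bounds strict and \<open>D\<close> positive.\<close>
  define D where "D = Suc (Max (insert 0 (\<delta> ` X \<union> word_degree \<delta> ` rels)))"
  have D: "k < D" if "k \<in> \<delta> ` X \<union> word_degree \<delta> ` rels" for k
    using that fin \<open>finite rels\<close> by (simp add: D_def less_Suc_eq_le)
  obtain n m where nm: "n < m" "label_state X D c n = label_state X D c m"
    using label_state_repeats[OF fin(1), of c K D] c_less by auto
  define p where "p = m - n"
  have m: "m = n + p" "0 < p" using nm by (auto simp: p_def)
  have window_map: "window_map \<delta> X R D a (transport D c a b)"
    if "label_state X D c a = label_state X D c b" for a b
  proof
    fix x s assume *: "x \<in> X" "\<not> is_zero s" "a \<le> \<delta> s" "\<delta> x + \<delta> s < a + D"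
    then have "s \<in> homog (a + (\<delta> s - a))" "\<delta> x + (\<delta> s - a) < D" by auto
    then show "transport D c a b (x * s) = x * transport D c a b s"
      by (rule transport_mult[OF that inj *(1)])
  next
    fix w assume "Some w \<in> fst ` R \<union> snd ` R"
    then show "word_degree \<delta> w < D" by (intro D) (simp add: rels_def)
  next
    fix x assume "x \<in> X"
    then show "\<delta> x \<le> D" using D[of "\<delta> x"] by simp
  next
    show "0 < D" by (simp add: D_def)
  qed (use pres transport_zero in auto)
  interpret window_map \<delta> X R D n "transport D c n m" by (rule window_map[OF nm(2)])
  have psi: "window_map \<delta> X R D (n + p) (transport D c m n)"
    using window_map[OF nm(2)[symmetric]] m by simp
  have window: "\<not> is_zero (transport D c n m e) \<and> \<delta> (transport D c n m e) = \<delta> e + p \<and>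
      transport D c m n (transport D c n m e) = e"
    if "\<not> is_zero e" "n \<le> \<delta> e" "\<delta> e < n + D" for e
  proof -
    have e: "e \<in> homog (n + (\<delta> e - n))" "\<delta> e - n < D" using that by auto
    show ?thesis
      using transport_window[OF nm(2) e] transport_inverse[OF nm(2) inj e] m that by auto
  qed
  note inverse = shift_inverse[OF psi window]
  have "shift_monoid \<delta> n p shift"
  proof
    show "inj_on shift {s. \<not> is_zero s \<and> n \<le> \<delta> s}"
      by (rule inj_on_inverseI[where g = "window_map.shift \<delta> X D (n + p) (transport D c m n)"])
        (simp add: inverse(1))
    show "0 < p" by (rule m(2))
    fix s assume s: "\<not> is_zero s" "n \<le> \<delta> s"
    show "\<not> is_zero (shift s)" by (rule inverse(2)[OF _ _ _ s])
    show "\<delta> (shift s) = \<delta> s + p" by (rule inverse(3)[OF _ _ _ s])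
  qed (fact shift_zero, fact shift_mult)
  then show ?thesis by blast
qed

end

section \<open>Iterates of the shift and their orbits\<close>

context shift_monoid
begin

lemma iter_zero: "is_zero z \<Longrightarrow> (\<Phi> ^^ k) z = z"
  by (induction k) (auto simp: shift_zero)

lemma iter_degree:
  assumes "\<not> is_zero s" "n \<le> \<delta> s"
  shows "\<not> is_zero ((\<Phi> ^^ k) s) \<and> \<delta> ((\<Phi> ^^ k) s) = \<delta> s + k * p"
  using assms by (induction k) (auto simp: shift_nonzero shift_degree)

lemma iter_mult:
  assumes "is_zero s \<or> n \<le> \<delta> s"
  shows "(\<Phi> ^^ k) (y * s) = y * (\<Phi> ^^ k) s"
proof (induction k)
  case (Suc k)
  have "is_zero ((\<Phi> ^^ k) s) \<or> n \<le> \<delta> ((\<Phi> ^^ k) s)"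
    using assms iter_zero iter_degree[of s k] by (cases "is_zero s") auto
  then show ?case using Suc shift_mult by simp
qed simp

lemma iter_inj: "inj_on (\<Phi> ^^ k) {s. \<not> is_zero s \<and> n \<le> \<delta> s}"
proof (induction k)
  case (Suc k)
  have "inj_on (\<Phi> \<circ> (\<Phi> ^^ k)) {s. \<not> is_zero s \<and> n \<le> \<delta> s}"
    using iter_degree by (intro comp_inj_on Suc inj_on_subset[OF shift_inj]) auto
  then show ?case by (simp add: comp_def)
qed simp

text \<open>
  If no \<open>w\<^sup>j b\<close> vanishes, shift the elements \<open>w\<^sup>j b\<close> with \<open>j = n + k p\<close>, \<open>k \<le> K\<close>, to a common
  degree; two of the results coincide.
\<close>

lemma sandwich_eventually_shift:
  assumes bound: "\<And>k. finite (homog k) \<and> card (homog k) \<le> K" and w: "0 < \<delta> w"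
  shows "\<exists>J q. 0 < q \<and> (\<forall>j\<ge>J. a * w ^ (j + q * p) * b = (\<Phi> ^^ (q * \<delta> w)) (a * w ^ j * b))"
\<comment> \<open>The factor \<open>a\<close> is left out so that the pigeonhole argument has
  nonzero elements; left multiplication restores it, even if the product vanishes. If some
  \<open>w ^ j * b\<close> is zero, both sides are eventually zero.\<close>
proof (cases "\<exists>j. is_zero (w ^ j * b)")
  case True
  then obtain J where J: "is_zero (w ^ J * b)" by blast
  have zero: "is_zero (a * w ^ j * b)" if "J \<le> j" for j
  proof -
    have "w ^ j = w ^ (j - J) * w ^ J" using that by (simp flip: power_add)
    then have "a * w ^ j * b = a * w ^ (j - J) * (w ^ J * b)" by (simp add: mult.assoc)
    then show ?thesis using J is_zero_mult by metis
  qed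
  have "a * w ^ (j + 1 * p) * b = (\<Phi> ^^ (1 * \<delta> w)) (a * w ^ j * b)" if "J \<le> j" for j
    using zero[of j] zero[of "j + 1 * p"] that iter_zero is_zero_unique by force
  then show ?thesis by (intro exI[of _ J] exI[of _ 1]) simp
next
  case False
  define y where "y j = w ^ j * b" for j
  have y: "\<not> is_zero (y j)" "\<delta> (y j) = j * \<delta> w + \<delta> b" for j
  proof -
    show *: "\<not> is_zero (y j)" using False by (simp add: y_def)
    then show "\<delta> (y j) = j * \<delta> w + \<delta> b"
      using deg_mult[of "w ^ j" b] deg_power[of w j] nonzero_factors[of "w ^ j" b] by (simp add: y_def)
  qed
  have y_large: "n \<le> \<delta> (y j)" if "n \<le> j" for j
  proof -
    have "n * 1 \<le> j * \<delta> w" using that w by (intro mult_le_mono) auto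
    then show ?thesis using y by simp
  qed
  \<comment> \<open>Each unit of \<open>k\<close> raises the degree of \<open>y (n + k * p)\<close>
    by \<open>p * \<delta> w\<close>, and each application of \<open>\<Phi>\<close> adds
    \<open>p\<close>; the exponent levels all these degrees.\<close>
  define z where "z k = (\<Phi> ^^ ((K - k) * \<delta> w)) (y (n + k * p))" for k
  have z: "z k \<in> homog ((n + K * p) * \<delta> w + \<delta> b)" if "k \<le> K" for k
  proof -
    have "n \<le> n + k * p" by simp
    then have "\<not> is_zero (z k)" "\<delta> (z k) = (n + k * p) * \<delta> w + \<delta> b + (K - k) * \<delta> w * p"
      using iter_degree[OF y(1) y_large] unfolding z_def by (simp_all add: y(2))
    moreover have "K * p * \<delta> w = k * p * \<delta> w + (K - k) * \<delta> w * p"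
      using that by (metis (no_types, lifting) add_mult_distrib le_add_diff_inverse mult.assoc mult.commute)
    ultimately show ?thesis by (simp add: add_mult_distrib)
  qed
  have "\<not> inj_on z {0..K}"
  proof
    assume "inj_on z {0..K}"
    then have "card {0..K} \<le> card (homog ((n + K * p) * \<delta> w + \<delta> b))"
    proof (rule card_inj_on_le)
      show "z ` {0..K} \<subseteq> homog ((n + K * p) * \<delta> w + \<delta> b)"
        by (rule image_subsetI) (use z in simp)
    qed (use bound in blast)
    then show False using bound[of "(n + K * p) * \<delta> w + \<delta> b"] by simp
  qed
  then obtain k1 k2 where k: "k1 < k2" "k2 \<le> K" "z k1 = z k2"
    unfolding inj_on_def by (metis atLeastAtMost_iff linorder_neqE_nat)
  define q where "q = k2 - k1"
  define J where "J = n + k1 * p"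
  have Jq: "n + k2 * p = J + q * p" using k by (simp add: J_def q_def algebra_simps diff_mult_distrib)
  have "(K - k1) * \<delta> w = (K - k2) * \<delta> w + q * \<delta> w"
    using k by (simp add: q_def flip: add_mult_distrib)
  then have "(\<Phi> ^^ ((K - k2) * \<delta> w)) ((\<Phi> ^^ (q * \<delta> w)) (y J)) = (\<Phi> ^^ ((K - k2) * \<delta> w)) (y (J + q * p))"
    using k(3) Jq unfolding z_def J_def by (simp add: funpow_add)
  \<comment> \<open>Injectivity cancels the common outer iterates of \<open>\<Phi>\<close>.\<close>
  then have per: "(\<Phi> ^^ (q * \<delta> w)) (y J) = y (J + q * p)"
  proof (rule inj_onD[OF iter_inj[of "(K - k2) * \<delta> w"]])
    have J: "n \<le> \<delta> (y J)" "n \<le> \<delta> (y (J + q * p))" by (intro y_large; simp add: J_def)+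
    then show "(\<Phi> ^^ (q * \<delta> w)) (y J) \<in> {s. \<not> is_zero s \<and> n \<le> \<delta> s}"
      using iter_degree[OF y(1) J(1), of "q * \<delta> w"] by simp
    show "y (J + q * p) \<in> {s. \<not> is_zero s \<and> n \<le> \<delta> s}"
      using J(2) y(1) by blast
  qed
  \<comment> \<open>The instance at \<open>J\<close> suffices, as iterates of \<open>\<Phi>\<close>
    commute with left multiplication by \<open>a * w ^ (j - J)\<close>.\<close>
  have "a * w ^ (j + q * p) * b = (\<Phi> ^^ (q * \<delta> w)) (a * w ^ j * b)" if "J \<le> j" for j
  proof -
    have split: "a * w ^ (j + i) * b = (a * w ^ (j - J)) * y (J + i)" for i
    proof -
      have "w ^ (j + i) = w ^ (j - J) * w ^ (J + i)" using that by (simp flip: power_add)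
      then show ?thesis by (simp add: y_def mult.assoc)
    qed
    show ?thesis
      using split[of 0] split[of "q * p"] iter_mult[of "y J" "q * \<delta> w" "a * w ^ (j - J)"]
        y_large[of J] per by (simp add: J_def)
  qed
  moreover have "0 < q" using k by (simp add: q_def)
  ultimately show ?thesis by blast
qed

lemma sandwich_shift_multiple:
  assumes "\<And>j. J \<le> j \<Longrightarrow> a * w ^ (j + r) * b = (\<Phi> ^^ q) (a * w ^ j * b)" "J \<le> j"
  shows "a * w ^ (j + m * r) * b = (\<Phi> ^^ (m * q)) (a * w ^ j * b)"
proof (induction m)
  case (Suc m)
  have "a * w ^ (j + Suc m * r) * b = (\<Phi> ^^ q) (a * w ^ (j + m * r) * b)"
    using assms(1)[of "j + m * r"] assms(2) by (simp add: ac_simps)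
  then show ?case using Suc by (simp add: funpow_add)
qed simp

text \<open>Injectivity of \<open>\<Phi> ^^ Q\<close> separates the orbits. That they reach every
  nonzero element of large degree comes from the sandwich form, which allows a step back by lowering
  the exponent.\<close>

lemma disjoint_free_sandwiches:
  assumes U: "finite \<U>" "\<forall>U\<in>\<U>. is_sandwich U" "(UNIV :: 'a set) = \<Union>\<U>"
  shows "\<exists>(F :: 'a set) (k :: nat) U. finite F \<and> (\<forall>i<k. is_free_sandwich (U i)) \<and>
               disjoint_family_on U {..<k} \<and> UNIV = F \<union> (\<Union>i<k. U i)"
proof -
  note bound = homog_card_bound[OF U]
  obtain A W B where ABW: "\<And>V. V \<in> \<U> \<Longrightarrow> V = sandwich (A V) (W V) (B V)"
    using U(2) unfolding is_sandwich_def by metis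
  have "\<exists>J q. 0 < q \<and> (0 < \<delta> (W V) \<longrightarrow> (\<forall>j\<ge>J.
      A V * W V ^ (j + q * p) * B V = (\<Phi> ^^ (q * \<delta> (W V))) (A V * W V ^ j * B V)))" for V
    using sandwich_eventually_shift[OF bound, of "W V" "A V" "B V"] by (cases "0 < \<delta> (W V)") auto
  then obtain J q where q: "\<And>V. 0 < q V" and per: "\<And>V j. 0 < \<delta> (W V) \<Longrightarrow> J V \<le> j \<Longrightarrow>
      A V * W V ^ (j + q V * p) * B V = (\<Phi> ^^ (q V * \<delta> (W V))) (A V * W V ^ j * B V)"
    by metis
  \<comment> \<open>\<open>Q\<close> is a common multiple of the numbers
    \<open>q V * \<delta> (W V)\<close> with positive \<open>\<delta> (W V)\<close>; the
    \<open>if\<close> keeps it positive when some \<open>W V\<close> has degree 0.\<close>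
  define Q where "Q = (\<Prod>V\<in>\<U>. q V * (if \<delta> (W V) = 0 then 1 else \<delta> (W V)))"
  define P where "P = Q * p"
  have "0 < Q" unfolding Q_def using q by (intro prod_pos) auto
  then have P: "0 < P" using p_pos by (simp add: P_def)
  have period: "\<exists>r. r * \<delta> (W V) = P \<and> (\<forall>j\<ge>J V.
      A V * W V ^ (j + r) * B V = (\<Phi> ^^ Q) (A V * W V ^ j * B V))"
    if V: "V \<in> \<U>" "0 < \<delta> (W V)" for V
  proof -
    have "q V * \<delta> (W V) dvd Q"
      using dvd_prodI[OF U(1) V(1), of "\<lambda>V. q V * (if \<delta> (W V) = 0 then 1 else \<delta> (W V))"] V(2)
      by (simp add: Q_def)
    then obtain m where m: "Q = m * (q V * \<delta> (W V))" by (metis dvd_def mult.commute)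
    then show ?thesis
      using sandwich_shift_multiple[OF per[OF V(2)]]
      by (intro exI[of _ "m * (q V * p)"]) (simp add: P_def algebra_simps)
  qed
  define M where "M = Suc (n + (\<Sum>V\<in>\<U>. \<delta> (A V) + J V * \<delta> (W V) + \<delta> (B V)))"
  have M: "\<delta> (A V) + J V * \<delta> (W V) + \<delta> (B V) < M" if "V \<in> \<U>" for V
    using member_le_sum[of V \<U> "\<lambda>V. \<delta> (A V) + J V * \<delta> (W V) + \<delta> (B V)"] that U(1)
    by (simp add: M_def)
  \<comment> \<open>The degree bound forces positive \<open>\<delta> (W V)\<close> and leaves room
    to lower the exponent \<open>i\<close> times by \<open>r\<close> without passing
    \<open>J V\<close>. The cases \<open>i = 0\<close> and \<open>i = 1\<close> serve freeness and
    covering.\<close>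
  have large: "\<exists>V r j. V \<in> \<U> \<and> s = A V * W V ^ j * B V \<and> J V + i * r \<le> j \<and> r * \<delta> (W V) = P \<and>
      (\<forall>j\<ge>J V. A V * W V ^ (j + r) * B V = (\<Phi> ^^ Q) (A V * W V ^ j * B V))"
    if s: "\<not> is_zero s" "M + i * P \<le> \<delta> s" for s i
  proof -
    obtain V where V: "V \<in> \<U>" "s \<in> V" using U(3) by blast
    then obtain j where j: "s = A V * W V ^ j * B V" using ABW[OF V(1)] by (auto simp: sandwich_def)
    have deg: "\<delta> s = \<delta> (A V) + j * \<delta> (W V) + \<delta> (B V)" using deg_sandwich s(1) j by simp
    have less: "J V * \<delta> (W V) + i * P < j * \<delta> (W V)" using deg s(2) M[OF V(1)] by linarith
    then have "0 < \<delta> (W V)" by (metis gr0I mult_0_right not_less0)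
    then obtain r where r: "r * \<delta> (W V) = P"
      "\<forall>j\<ge>J V. A V * W V ^ (j + r) * B V = (\<Phi> ^^ Q) (A V * W V ^ j * B V)"
      using period[OF V(1)] by blast
    have "(J V + i * r) * \<delta> (W V) < j * \<delta> (W V)" using less r(1) by (simp add: algebra_simps)
    then have "J V + i * r \<le> j" by (metis mult_less_cancel2 less_imp_le)
    then show ?thesis using V(1) j r by blast
  qed
  define orbit where "orbit e = range (\<lambda>k. (\<Phi> ^^ (k * Q)) e)" for e
  define E where "E = {e. \<not> is_zero e \<and> M \<le> \<delta> e \<and> \<delta> e < M + P}"
  have Mn: "n \<le> M" by (simp add: M_def)
  have orbit_degree: "\<delta> ((\<Phi> ^^ (k * Q)) e) = \<delta> e + k * P" if "\<not> is_zero e" "M \<le> \<delta> e" for k e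
    using iter_degree[of e "k * Q"] that Mn by (simp add: P_def mult.assoc)
  have free: "is_free_sandwich (orbit e)" if "e \<in> E" for e
  proof -
    have e: "\<not> is_zero e" "M \<le> \<delta> e" using that by (auto simp: E_def)
    then obtain V r j where V: "e = A V * W V ^ j * B V" "J V \<le> j"
      "\<forall>j\<ge>J V. A V * W V ^ (j + r) * B V = (\<Phi> ^^ Q) (A V * W V ^ j * B V)"
      using large[of e 0] by auto
    \<comment> \<open>Each application of \<open>\<Phi> ^^ Q\<close> raises the exponent by
      \<open>r\<close>, so the orbit is a sandwich around \<open>W V ^ r\<close>.\<close>
    have "(\<Phi> ^^ (k * Q)) e = (A V * W V ^ j) * (W V ^ r) ^ k * B V" for k
      using sandwich_shift_multiple[of "J V" "A V" "W V" r "B V" Q j k] V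
      by (simp add: power_add power_mult[symmetric] mult.assoc mult.commute[of r k])
    moreover have "inj (\<lambda>k. (\<Phi> ^^ (k * Q)) e)"
    proof (rule injI)
      fix k k' assume "(\<Phi> ^^ (k * Q)) e = (\<Phi> ^^ (k' * Q)) e"
      then have "\<delta> e + k * P = \<delta> e + k' * P" using orbit_degree[OF e] by metis
      then show "k = k'" using P by simp
    qed
    ultimately show ?thesis
      unfolding is_free_sandwich_def orbit_def sandwich_def
      by (intro exI[of _ "A V * W V ^ j"] exI[of _ "W V ^ r"] exI[of _ "B V"]) auto
  qed
  have disjoint: "e = e'" if e: "e \<in> E" "e' \<in> E" and s: "s \<in> orbit e" "s \<in> orbit e'" for e e' s
  proof -
    obtain k k' where k: "s = (\<Phi> ^^ (k * Q)) e" "s = (\<Phi> ^^ (k' * Q)) e'"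
      using s unfolding orbit_def by blast
    have eE: "\<not> is_zero e" "M \<le> \<delta> e" "\<not> is_zero e'" "M \<le> \<delta> e'" using e by (auto simp: E_def)
    have "\<delta> e + k * P = \<delta> e' + k' * P" using k orbit_degree eE by metis
    \<comment> \<open>Both degrees lie in the window of length \<open>P\<close> starting at
      \<open>M\<close>, so division by \<open>P\<close> recovers the number of steps.\<close>
    then have "(\<delta> e - M + k * P) div P = (\<delta> e' - M + k' * P) div P" using eE by simp
    then have "k = k'"
      using e P by (simp add: E_def less_diff_conv2)
    show ?thesis
    proof (rule inj_onD[OF iter_inj[of "k * Q"]])
      show "(\<Phi> ^^ (k * Q)) e = (\<Phi> ^^ (k * Q)) e'" using k \<open>k = k'\<close> by metis
    qed (use eE Mn in simp_all)
  qed
  have cover: "\<exists>e\<in>E. s \<in> orbit e" if "\<not> is_zero s" "M \<le> \<delta> s" for s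
    using that
  proof (induction "\<delta> s" arbitrary: s rule: less_induct)
    case less
    show ?case
    proof (cases "\<delta> s < M + P")
      case True
      have "s \<in> orbit s" unfolding orbit_def by (rule range_eqI[of _ _ 0]) simp
      moreover have "s \<in> E" using True less.prems by (simp add: E_def)
      ultimately show ?thesis by blast
    next
      case False
      then obtain V r j where V: "s = A V * W V ^ j * B V" "J V + r \<le> j" "r * \<delta> (W V) = P"
        "\<forall>j\<ge>J V. A V * W V ^ (j + r) * B V = (\<Phi> ^^ Q) (A V * W V ^ j * B V)"
        using large[of s 1] less.prems by auto
      \<comment> \<open>\<open>t\<close> is the preimage of \<open>s\<close> under
        \<open>\<Phi> ^^ Q\<close> inside the same sandwich; its degree is smaller by
        \<open>P\<close>.\<close>
      define t where "t = A V * W V ^ (j - r) * B V"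
      have "J V \<le> j - r" "j - r + r = j" using V(2) by auto
      then have st: "s = (\<Phi> ^^ Q) t" using V(1,4) unfolding t_def by metis
      then have t: "\<not> is_zero t" using iter_zero less.prems(1) by metis
      have "\<delta> s = \<delta> (A V) + ((j - r) + r) * \<delta> (W V) + \<delta> (B V)"
        using deg_sandwich less.prems(1) V(1) \<open>j - r + r = j\<close> by metis
      also have "\<dots> = \<delta> t + P"
        using deg_sandwich[of "A V" "W V" "j - r" "B V"] t V(3) by (simp add: t_def algebra_simps)
      finally have "\<delta> s = \<delta> t + P" .
      then obtain e where e: "e \<in> E" "t \<in> orbit e" using less.hyps[of t] t False P by auto
      then obtain k where "t = (\<Phi> ^^ (k * Q)) e" unfolding orbit_def by blast
      then have "s = (\<Phi> ^^ (Suc k * Q)) e" using st by (simp add: funpow_add)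
      then show ?thesis using e(1) unfolding orbit_def by blast
    qed
  qed
  have finF: "finite {s. is_zero s \<or> \<delta> s < k}" for k
    using bound by (intro finite_bounded_degree) blast
  have "finite E" by (rule finite_subset[OF _ finF[of "M + P"]]) (auto simp: E_def)
  then obtain f where f: "bij_betw f {..<card E} E"
    using ex_bij_betw_nat_finite[of E] by (auto simp: atLeast0LessThan)
  have fE: "f i \<in> E" if "i < card E" for i using f that by (auto simp: bij_betw_def)
  show ?thesis
  proof (intro exI conjI)
    show "finite {s. is_zero s \<or> \<delta> s < M}" by (rule finF)
    show "\<forall>i<card E. is_free_sandwich (orbit (f i))" using free fE by blast
    show "disjoint_family_on (\<lambda>i. orbit (f i)) {..<card E}"
    proof (unfold disjoint_family_on_def, intro ballI impI)
      fix i j assume ij: "i \<in> {..<card E}" "j \<in> {..<card E}" "i \<noteq> j"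
      then have "f i \<noteq> f j" using f by (auto simp: bij_betw_def inj_on_def)
      then show "orbit (f i) \<inter> orbit (f j) = {}" using disjoint fE ij by blast
    qed
    show "UNIV = {s. is_zero s \<or> \<delta> s < M} \<union> (\<Union>i<card E. orbit (f i))"
    proof (intro equalityI subsetI)
      fix s :: 'a
      show "s \<in> {s. is_zero s \<or> \<delta> s < M} \<union> (\<Union>i<card E. orbit (f i))"
      proof (cases "is_zero s \<or> \<delta> s < M")
        case False
        then obtain e where "e \<in> E" "s \<in> orbit e" using cover[of s] by auto
        moreover from this obtain i where "i < card E" "e = f i"
          using f by (auto simp: bij_betw_def)
        ultimately show ?thesis by auto
      qed simp
    qed simp
  qed
qed

end

section \<open>Closing the circle of implications\<close>

lemma free_sandwiches_imp_sandwiches: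
  fixes k :: nat
  assumes "finite F" "\<forall>i<k. is_free_sandwich (U i)" "(UNIV :: 'a::monoid_mult set) = F \<union> (\<Union>i<k. U i)"
  shows "\<exists>\<U> :: 'a set set. finite \<U> \<and> (\<forall>U\<in>\<U>. is_sandwich U) \<and> UNIV = \<Union>\<U>"
proof -
  define \<U> where "\<U> = (\<lambda>a. sandwich a 1 1) ` F \<union> U ` {..<k}"
  have "sandwich a 1 1 = {a}" for a :: 'a by (auto simp: sandwich_def)
  then have "UNIV = \<Union>\<U>" using assms(3) by (auto simp: \<U>_def)
  moreover have "\<forall>V\<in>\<U>. is_sandwich V"
    using assms(2) unfolding \<U>_def is_free_sandwich_def is_sandwich_def by blast
  moreover have "finite \<U>" using assms(1) by (simp add: \<U>_def)
  ultimately show ?thesis by blast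
qed

theorem theorem1:
  assumes "homogeneous TYPE('a::monoid_mult)"
    and "finitely_presented TYPE('a)"
  shows "(at_most_linear_growth TYPE('a) \<longleftrightarrow>
            (\<exists>\<U> :: 'a set set. finite \<U> \<and> (\<forall>U\<in>\<U>. is_sandwich U) \<and> UNIV = \<Union>\<U>)) \<and>
         ((\<exists>\<U> :: 'a set set. finite \<U> \<and> (\<forall>U\<in>\<U>. is_sandwich U) \<and> UNIV = \<Union>\<U>) \<longleftrightarrow>
            (\<exists>(F :: 'a set) (k :: nat) U. finite F \<and> (\<forall>i<k. is_free_sandwich (U i)) \<and>
               disjoint_family_on U {..<k} \<and> UNIV = F \<union> (\<Union>i<k. U i)))"
proof -
  obtain \<delta> :: "'a \<Rightarrow> nat" where "graded_monoid \<delta>"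
    using homogeneous_imp_graded[OF assms(1)] by blast
  then interpret graded_monoid \<delta> .
  have "\<exists>(F :: 'a set) (k :: nat) U. finite F \<and> (\<forall>i<k. is_free_sandwich (U i)) \<and>
      disjoint_family_on U {..<k} \<and> UNIV = F \<union> (\<Union>i<k. U i)"
    if U: "finite \<U>" "\<forall>U\<in>\<U>. is_sandwich U" "(UNIV :: 'a set) = \<Union>\<U>" for \<U>
  proof -
    obtain n p \<Phi> where "shift_monoid \<delta> n p \<Phi>"
      using exists_shift[OF assms(2) homog_card_bound[OF U]] by blast
    then interpret shift_monoid \<delta> n p \<Phi> .
    show ?thesis by (rule disjoint_free_sandwiches[OF U])
  qed
  then show ?thesis
    using linear_growth_imp_sandwiches sandwiches_imp_linear_growth free_sandwiches_imp_sandwiches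
    by meson
qed

end
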